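(* Let $G$ be an msp-digraph. Then $\chi_o(G)\leq 7$.
   Context: A source is a vertex of indegree $0$, a sink a vertex of outdegree $0$. For vertex-disjoint digraphs $G_1=(V_1,E_1)$, $G_2=(V_2,E_2)$, let $O_1$ be the set of sinks of $G_1$ and $I_2$ the set of sources of $G_2$. The parallel composition is $G_1\cup G_2=(V_1\cup V_2,E_1\cup E_2)$; the series composition is $G_1\times G_2=(V_1\cup V_2,E_1\cup E_2\cup\{(v,w)\mid v\in O_1, w\in I_2\})$. Msp-digraphs are defined recursively: every single-vertex digraph is an msp-digraph, and if $G_1,G_2$ are vertex-disjoint msp-digraphs then $G_1\cup G_2$ and $G_1\times G_2$ are msp-digraphs. An oriented $r$-coloring of an oriented graph $G=(V,E)$ is a map $c:V\to\{1,\dots,r\}$ with $c(u)\neq c(v)$ for every $(u,v)\in E$, and $c(u)\neq c(y)$ for every two arcs $(u,v),(x,y)\in E$ with $c(v)=c(x)$; $\chi_o(G)$ is the smallest such $r$. *)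

theory Defs
  imports "Graph_Theory.Pair_Digraph"
begin

definition sources :: "'a pair_pre_digraph \<Rightarrow> 'a set" where
  "sources G = {v \<in> pverts G. in_degree (with_proj G) v = 0}"

definition sinks :: "'a pair_pre_digraph \<Rightarrow> 'a set" where
  "sinks G = {v \<in> pverts G. out_degree (with_proj G) v = 0}"

definition parallel_comp :: "'a pair_pre_digraph \<Rightarrow> 'a pair_pre_digraph \<Rightarrow> 'a pair_pre_digraph"
  where
  "parallel_comp G H = \<lparr> pverts = pverts G \<union> pverts H, parcs = parcs G \<union> parcs H \<rparr>"

definition series_comp :: "'a pair_pre_digraph \<Rightarrow> 'a pair_pre_digraph \<Rightarrow> 'a pair_pre_digraph"
  where
  "series_comp G H =
     \<lparr> pverts = pverts G \<union> pverts H,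
       parcs = parcs G \<union> parcs H \<union> {(v, w). v \<in> sinks G \<and> w \<in> sources H} \<rparr>"

inductive msp_digraph :: "'a pair_pre_digraph \<Rightarrow> bool" where
  single: "msp_digraph \<lparr> pverts = {v}, parcs = {} \<rparr>"
| parallel: "\<lbrakk> msp_digraph G; msp_digraph H; pverts G \<inter> pverts H = {} \<rbrakk>
    \<Longrightarrow> msp_digraph (parallel_comp G H)"
| series: "\<lbrakk> msp_digraph G; msp_digraph H; pverts G \<inter> pverts H = {} \<rbrakk>
    \<Longrightarrow> msp_digraph (series_comp G H)"

definition oriented_graph :: "'a pair_pre_digraph \<Rightarrow> bool" where
  "oriented_graph G \<longleftrightarrow>
     pair_digraph G \<and> (\<forall>u v. (u, v) \<in> parcs G \<longrightarrow> (v, u) \<notin> parcs G)"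

definition oriented_coloring :: "'a pair_pre_digraph \<Rightarrow> nat \<Rightarrow> ('a \<Rightarrow> nat) \<Rightarrow> bool" where
  "oriented_coloring G r c \<longleftrightarrow>
     c \<in> pverts G \<rightarrow> {1..r} \<and>
     (\<forall>(u, v) \<in> parcs G. c u \<noteq> c v) \<and>
     (\<forall>(u, v) \<in> parcs G. \<forall>(x, y) \<in> parcs G. c v = c x \<longrightarrow> c u \<noteq> c y)"

text \<open>The least number below is meaningful for every (finite) oriented graph, in particular for
  every msp-digraph: see the lemmas \<open>oriented_coloring_exists\<close> and \<open>msp_oriented_graph\<close>.\<close>

definition oriented_chromatic_number :: "'a pair_pre_digraph \<Rightarrow> nat" where
  "oriented_chromatic_number G = (LEAST r. \<exists>c. oriented_coloring G r c)"

lemma oriented_coloring_exists: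
  assumes "oriented_graph G"
  shows "\<exists>r c. oriented_coloring G r c"
proof -
  interpret pair_digraph G using assms by (simp add: oriented_graph_def)
  have fin: "finite (pverts G)" by (rule pair_finite_verts)
  obtain c where c: "bij_betw c (pverts G) {1..card (pverts G)}"
    using fin finite_same_card_bij[of "pverts G" "{1..card (pverts G)}"] by auto
  have inj: "\<And>u v. u \<in> pverts G \<Longrightarrow> v \<in> pverts G \<Longrightarrow> c u = c v \<Longrightarrow> u = v"
    using c by (auto simp: bij_betw_def inj_on_def)
  have ends: "u \<in> pverts G" "v \<in> pverts G" if "(u, v) \<in> parcs G" for u v
    using in_arcsD1[OF that] in_arcsD2[OF that] by simp_all
  have noloop: "(u, u) \<notin> parcs G" for u
    using assms by (auto simp: oriented_graph_def)
  have range: "c \<in> pverts G \<rightarrow> {1..card (pverts G)}"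
    using c by (auto simp: bij_betw_def)
  have proper: "c u \<noteq> c v" if "(u, v) \<in> parcs G" for u v
    using that inj ends noloop by metis
  have compat: "c u \<noteq> c y" if "(u, v) \<in> parcs G" "(x, y) \<in> parcs G" "c v = c x" for u v x y
    using that inj ends assms unfolding oriented_graph_def by metis
  have "oriented_coloring G (card (pverts G)) c"
    unfolding oriented_coloring_def using range proper compat by blast
  thus ?thesis by blast
qed

lemma oriented_graph_iff:
  "oriented_graph G \<longleftrightarrow> finite (pverts G) \<and> parcs G \<subseteq> pverts G \<times> pverts G \<and>
     (\<forall>u v. (u, v) \<in> parcs G \<longrightarrow> (v, u) \<notin> parcs G)" (is "?L \<longleftrightarrow> ?R")
proof
  assume L: ?L
  then interpret pair_digraph G by (simp add: oriented_graph_def)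
  show ?R using L in_arcsD1 in_arcsD2 by (auto simp: oriented_graph_def)
next
  assume R: ?R
  hence "finite (parcs G)" by (meson finite_SigmaI finite_subset)
  with R have "pair_digraph G" by unfold_locales (auto, blast)
  with R show ?L by (simp add: oriented_graph_def)
qed

lemma msp_oriented_graph: "msp_digraph G \<Longrightarrow> oriented_graph G"
proof (induction rule: msp_digraph.induct)
  case (single v)
  show ?case by (simp add: oriented_graph_iff)
next
  case (parallel G H)
  thus ?case by (fastforce simp: oriented_graph_iff parallel_comp_def)
next
  case (series G H)
  thus ?case by (fastforce simp: oriented_graph_iff series_comp_def sinks_def sources_def)
qed

end

theory Submission
  imports Defs
begin

text \<open>In the Paley tournament on seven vertices every arc \<open>s \<rightarrow> z\<close> is bypassed by a path
  \<open>s \<rightarrow> y \<rightarrow> z\<close>. This property alone lets one show by induction that for every arc \<open>s \<rightarrow> z\<close> each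
  msp-digraph has a homomorphism into the tournament that sends all sources to \<open>s\<close> and all sinks
  to in-neighbours of \<open>z\<close>: for a series composition, use \<open>s \<rightarrow> y\<close> on the first part and \<open>y \<rightarrow> z\<close>
  on the second, so that the new arcs go from in-neighbours of \<open>y\<close> to \<open>y\<close>.\<close>

text \<open>Degrees are cardinalities, and \<open>card\<close> is 0 on infinite sets too; finiteness
  makes indegree 0 mean that no arc enters.\<close>

lemma sources_iff:
  assumes "finite (parcs G)"
  shows "v \<in> sources G \<longleftrightarrow> v \<in> pverts G \<and> (\<forall>u. (u, v) \<notin> parcs G)"
  using assms by (auto simp: sources_def in_degree_def in_arcs_def)

lemma sinks_iff:
  assumes "finite (parcs G)"
  shows "v \<in> sinks G \<longleftrightarrow> v \<in> pverts G \<and> (\<forall>w. (v, w) \<notin> parcs G)"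
  using assms by (auto simp: sinks_def out_degree_def out_arcs_def)

lemma sources_in_pverts: "v \<in> sources G \<Longrightarrow> v \<in> pverts G"
  by (simp add: sources_def)

lemma sinks_in_pverts: "v \<in> sinks G \<Longrightarrow> v \<in> pverts G"
  by (simp add: sinks_def)

lemma msp_finite_parcs: "msp_digraph G \<Longrightarrow> finite (parcs G)"
  using msp_oriented_graph by (metis finite_SigmaI finite_subset oriented_graph_iff)

lemma msp_arc_ends:
  assumes "msp_digraph G" "(u, v) \<in> parcs G"
  shows "u \<in> pverts G" "v \<in> pverts G"
  using assms msp_oriented_graph by (auto simp: oriented_graph_iff)

lemmas msp_sources_iff = sources_iff[OF msp_finite_parcs]
lemmas msp_sinks_iff = sinks_iff[OF msp_finite_parcs]

lemma sources_parallel: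
  assumes "msp_digraph G" "msp_digraph H" "pverts G \<inter> pverts H = {}"
  shows "sources (parallel_comp G H) = sources G \<union> sources H"
  using assms msp_digraph.parallel[OF assms] msp_arc_ends[OF assms(1)]
    msp_arc_ends[OF assms(2)]
  by (fastforce simp: msp_sources_iff parallel_comp_def disjoint_iff)

lemma sinks_parallel:
  assumes "msp_digraph G" "msp_digraph H" "pverts G \<inter> pverts H = {}"
  shows "sinks (parallel_comp G H) = sinks G \<union> sinks H"
  using assms msp_digraph.parallel[OF assms] msp_arc_ends[OF assms(1)]
    msp_arc_ends[OF assms(2)]
  by (fastforce simp: msp_sinks_iff parallel_comp_def disjoint_iff)

text \<open>The added arcs start in \<open>G\<close>, so by disjointness no sink of \<open>H\<close>
  gains an outgoing arc. The converse inclusion needs a source of \<open>H\<close>, hence comes only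
  after the nonemptiness lemmas.\<close>

lemma sinks_subset_series:
  assumes "msp_digraph G" "msp_digraph H" "pverts G \<inter> pverts H = {}"
  shows "sinks H \<subseteq> sinks (series_comp G H)"
  using assms msp_digraph.series[OF assms] msp_arc_ends[OF assms(1)]
    msp_arc_ends[OF assms(2)]
  by (fastforce simp: msp_sinks_iff series_comp_def disjoint_iff)

lemma sources_subset_series:
  assumes "msp_digraph G" "msp_digraph H" "pverts G \<inter> pverts H = {}"
  shows "sources G \<subseteq> sources (series_comp G H)"
  using assms msp_digraph.series[OF assms] msp_arc_ends[OF assms(1)]
    msp_arc_ends[OF assms(2)]
  by (fastforce simp: msp_sources_iff series_comp_def disjoint_iff)

lemma msp_sinks_nonempty: "msp_digraph G \<Longrightarrow> sinks G \<noteq> {}"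
proof (induction rule: msp_digraph.induct)
  case (single v)
  show ?case by (auto simp: set_eq_iff sinks_iff)
next
  case (parallel G H)
  thus ?case by (simp add: sinks_parallel)
next
  case (series G H)
  thus ?case using sinks_subset_series by blast
qed

lemma msp_sources_nonempty: "msp_digraph G \<Longrightarrow> sources G \<noteq> {}"
proof (induction rule: msp_digraph.induct)
  case (single v)
  show ?case by (auto simp: set_eq_iff sources_iff)
next
  case (parallel G H)
  thus ?case by (simp add: sources_parallel)
next
  case (series G H)
  thus ?case using sources_subset_series by blast
qed

text \<open>A sink \<open>t\<close> of \<open>G\<close> exists, and it sends an arc to every source
  of \<open>H\<close>, so none of these remains a source.\<close>

lemma sources_series:
  assumes "msp_digraph G" "msp_digraph H" "pverts G \<inter> pverts H = {}"
  shows "sources (series_comp G H) = sources G"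
proof
  obtain t where t: "t \<in> sinks G"
    using msp_sinks_nonempty assms(1) by blast
  have fin: "finite (parcs (series_comp G H))"
    using msp_digraph.series[OF assms] by (rule msp_finite_parcs)
  show "sources (series_comp G H) \<subseteq> sources G"
  proof
    fix v assume v: "v \<in> sources (series_comp G H)"
    hence no_arc: "(u, v) \<notin> parcs (series_comp G H)" for u
      by (simp add: sources_iff[OF fin])
    have "v \<notin> sources H"
      using no_arc[of t] t by (simp add: series_comp_def)
    moreover have "v \<in> pverts G \<or> v \<in> pverts H"
      using v by (simp add: sources_iff[OF fin]) (simp add: series_comp_def)
    ultimately show "v \<in> sources G"
      using no_arc assms(1,2) by (auto simp: msp_sources_iff series_comp_def)
  qed
qed (rule sources_subset_series[OF assms])

lemma sinks_series:
  assumes "msp_digraph G" "msp_digraph H" "pverts G \<inter> pverts H = {}"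
  shows "sinks (series_comp G H) = sinks H"
proof
  obtain s where s: "s \<in> sources H"
    using msp_sources_nonempty assms(2) by blast
  have fin: "finite (parcs (series_comp G H))"
    using msp_digraph.series[OF assms] by (rule msp_finite_parcs)
  show "sinks (series_comp G H) \<subseteq> sinks H"
  proof
    fix v assume v: "v \<in> sinks (series_comp G H)"
    hence no_arc: "(v, w) \<notin> parcs (series_comp G H)" for w
      by (simp add: sinks_iff[OF fin])
    have "v \<notin> sinks G"
      using no_arc[of s] s by (simp add: series_comp_def)
    moreover have "v \<in> pverts G \<or> v \<in> pverts H"
      using v by (simp add: sinks_iff[OF fin]) (simp add: series_comp_def)
    ultimately show "v \<in> sinks H"
      using no_arc assms(1,2) by (auto simp: msp_sinks_iff series_comp_def)
  qed
qed (rule sinks_subset_series[OF assms])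

lemma msp_homomorphism:
  fixes A :: "'b \<Rightarrow> 'b \<Rightarrow> bool"
  assumes "msp_digraph G" "A s z"
    and bypass: "\<And>s z. A s z \<Longrightarrow> \<exists>y. A s y \<and> A y z"
  shows "\<exists>c. (\<forall>(u, v) \<in> parcs G. A (c u) (c v)) \<and> (\<forall>v \<in> sources G. c v = s) \<and>
    (\<forall>v \<in> sinks G. A (c v) z)"
  using assms(1,2)
proof (induction arbitrary: s z rule: msp_digraph.induct)
  case (single v)
  \<comment> \<open>The only vertex is both source and sink, so it must go to \<open>s\<close>, and
    \<open>A s z\<close> is the sink condition.\<close>
  thus ?case by (intro exI[of _ "\<lambda>_. s"]) simp
next
  case (parallel G H)
  obtain c where c: "\<forall>(u, v) \<in> parcs G. A (c u) (c v)" "\<forall>v \<in> sources G. c v = s"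
    "\<forall>v \<in> sinks G. A (c v) z"
    using parallel.IH(1)[OF parallel.prems] by blast
  obtain d where d: "\<forall>(u, v) \<in> parcs H. A (d u) (d v)" "\<forall>v \<in> sources H. d v = s"
    "\<forall>v \<in> sinks H. A (d v) z"
    using parallel.IH(2)[OF parallel.prems] by blast
  define e where "e v = (if v \<in> pverts G then c v else d v)" for v
  have eG: "e v = c v" if "v \<in> pverts G" for v using that by (simp add: e_def)
  have eH: "e v = d v" if "v \<in> pverts H" for v
    using that parallel.hyps(3) by (auto simp: e_def)
  have "\<forall>(u, v) \<in> parcs (parallel_comp G H). A (e u) (e v)"
    using c(1) d(1) msp_arc_ends[OF parallel.hyps(1)] msp_arc_ends[OF parallel.hyps(2)]
    by (auto simp: parallel_comp_def eG eH)
  moreover have "\<forall>v \<in> sources (parallel_comp G H). e v = s"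
    using c(2) d(2) by (auto simp: sources_parallel[OF parallel.hyps] eG eH sources_in_pverts)
  moreover have "\<forall>v \<in> sinks (parallel_comp G H). A (e v) z"
    using c(3) d(3) by (auto simp: sinks_parallel[OF parallel.hyps] eG eH sinks_in_pverts)
  ultimately show ?case by blast
next
  case (series G H)
  obtain y where y: "A s y" "A y z"
    using bypass series.prems by blast
  obtain c where c: "\<forall>(u, v) \<in> parcs G. A (c u) (c v)" "\<forall>v \<in> sources G. c v = s"
    "\<forall>v \<in> sinks G. A (c v) y"
    using series.IH(1)[OF y(1)] by blast
  obtain d where d: "\<forall>(u, v) \<in> parcs H. A (d u) (d v)" "\<forall>v \<in> sources H. d v = y"
    "\<forall>v \<in> sinks H. A (d v) z"
    using series.IH(2)[OF y(2)] by blast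
  define e where "e v = (if v \<in> pverts G then c v else d v)" for v
  have eG: "e v = c v" if "v \<in> pverts G" for v using that by (simp add: e_def)
  have eH: "e v = d v" if "v \<in> pverts H" for v
    using that series.hyps(3) by (auto simp: e_def)
  have "A (e u) (e v)" if "u \<in> sinks G" "v \<in> sources H" for u v
    using that c(3) d(2) by (auto simp: eG eH sinks_in_pverts sources_in_pverts)
  hence "\<forall>(u, v) \<in> parcs (series_comp G H). A (e u) (e v)"
    using c(1) d(1) msp_arc_ends[OF series.hyps(1)] msp_arc_ends[OF series.hyps(2)]
    by (auto simp: series_comp_def eG eH)
  moreover have "\<forall>v \<in> sources (series_comp G H). e v = s"
    using c(2) by (auto simp: sources_series[OF series.hyps] eG sources_in_pverts)
  moreover have "\<forall>v \<in> sinks (series_comp G H). A (e v) z"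
    using d(3) by (auto simp: sinks_series[OF series.hyps] eH sinks_in_pverts)
  ultimately show ?case by blast
qed

text \<open>1, 2, 4 are the nonzero squares mod 7. The summand 7 keeps the subtraction on
  \<open>nat\<close> from truncating.\<close>

definition paley7 :: "nat \<Rightarrow> nat \<Rightarrow> bool" where
  "paley7 p q \<longleftrightarrow> p < 7 \<and> q < 7 \<and> (q + 7 - p) mod 7 \<in> {1, 2, 4}"

lemma less7_cases: "p < (7::nat) \<longleftrightarrow> p \<in> {0, 1, 2, 3, 4, 5, 6}"
  by auto

text \<open>-1 is not a square mod 7, so a difference and its negative are never both nonzero
  squares.\<close>

lemma paley7_asym: "paley7 p q \<Longrightarrow> \<not> paley7 q p"
  unfolding paley7_def less7_cases by auto

text \<open>The midpoint exists because each non-zero square mod 7 is twice another one.\<close>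

lemma paley7_bypass:
  assumes "paley7 s z"
  shows "\<exists>y. paley7 s y \<and> paley7 y z"
proof -
  \<comment> \<open>Since 4 is the inverse of 2 mod 7, the witness is the midpoint of
    \<open>s\<close> and \<open>z\<close>. Both steps are 4(z - s) mod 7, a square because 4 is
    one.\<close>
  have "paley7 s ((s + 4 * (z + 7 - s)) mod 7) \<and> paley7 ((s + 4 * (z + 7 - s)) mod 7) z"
    using assms unfolding paley7_def less7_cases by auto
  thus ?thesis by blast
qed

theorem theorem5p7:
  fixes G :: "'a pair_pre_digraph"
  assumes "msp_digraph G"
  shows "oriented_chromatic_number G \<le> 7"
proof -
  \<comment> \<open>Some arc of the tournament is required to instantiate \<open>s\<close> and
    \<open>z\<close>.\<close>
  have "paley7 0 1" by (simp add: paley7_def)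
  then obtain c where c: "\<And>u v. (u, v) \<in> parcs G \<Longrightarrow> paley7 (c u) (c v)"
    using msp_homomorphism[OF assms _ paley7_bypass] by blast
  txt \<open>The vertices of the tournament are \<open>0, \<dots>, 6\<close>, the colours \<open>1, \<dots>, 7\<close>; reducing mod 7
    also covers isolated vertices, about which the homomorphism property says nothing.\<close>
  have c_mod: "c u mod 7 = c u" "c v mod 7 = c v" if "(u, v) \<in> parcs G" for u v
    using c[OF that] by (simp_all add: paley7_def)
  have irrefl: "\<not> paley7 p p" for p using paley7_asym by blast
  have "oriented_coloring G 7 (\<lambda>v. Suc (c v mod 7))"
    unfolding oriented_coloring_def
  proof (intro conjI)
    show "(\<lambda>v. Suc (c v mod 7)) \<in> pverts G \<rightarrow> {1..7}"
      by (auto simp: Suc_le_eq less_Suc_eq_le[symmetric])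
    show "\<forall>(u, v) \<in> parcs G. Suc (c u mod 7) \<noteq> Suc (c v mod 7)"
      using c irrefl by (fastforce simp: c_mod)
    \<comment> \<open>If both pairs of colours agreed, the images of the two arcs would be opposite
      arcs of the tournament.\<close>
    show "\<forall>(u, v) \<in> parcs G. \<forall>(x, y) \<in> parcs G. Suc (c v mod 7) = Suc (c x mod 7) \<longrightarrow>
        Suc (c u mod 7) \<noteq> Suc (c y mod 7)"
      using c paley7_asym by (fastforce simp: c_mod)
  qed
  thus ?thesis
    unfolding oriented_chromatic_number_def by (intro Least_le) blast
qed

end
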